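(* $L_\infty[0,1]$ has the 1-ASD2P$_\omega$.
   Context: $L_\infty[0,1]$ is the real Banach space of (classes of) essentially bounded functions on $[0,1]$ with Lebesgue measure. $S_X$ is the unit sphere of $X$. For $B\subset X$ and $A\subset X^*$, $B$ norms $A$ if for every $\lambda\in(0,1)$ and every $x^*\in A$ there is $x\in B\setminus\{0\}$ with $x^*(x)\ge\lambda\|x^*\|\|x\|$. $X$ has the 1-ASD2P$_\omega$ if for every countable set $A\subset S_{X^*}$ there are $B\subset S_X$ and $x^*\in S_{X^*}$ such that $B$ norms $A$ and $x^*(x)=1$ for every $x\in B$. (Equivalently, every convex series of slices of the unit ball of $X$ intersects $S_X$.) *)

theory Defs
  imports "HOL-Probability.Essential_Supremum"
begin

section \<open>The Banach space of essentially bounded functions on the unit interval\<close>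

abbreviation lebesgue01 :: "real measure" where
  "lebesgue01 \<equiv> lebesgue_on {0..1}"

definition ess_bounded :: "(real \<Rightarrow> real) \<Rightarrow> bool" where
  "ess_bounded f \<longleftrightarrow>
     f \<in> borel_measurable lebesgue01 \<and> esssup lebesgue01 (\<lambda>t. ereal \<bar>f t\<bar>) < \<infinity>"

text \<open>Representatives are total functions on the reals, but all conditions are relative to
  \<^const>\<open>lebesgue01\<close>, so their values outside the unit interval are irrelevant.\<close>

definition linf_rel :: "(real \<Rightarrow> real) \<Rightarrow> (real \<Rightarrow> real) \<Rightarrow> bool" where
  "linf_rel f g \<longleftrightarrow> ess_bounded f \<and> ess_bounded g \<and> (AE t in lebesgue01. f t = g t)"

lemma emeasure_lebesgue01: "emeasure lebesgue01 (space lebesgue01) = 1"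
  by (simp add: emeasure_restrict_space)

lemma ess_bounded_iff:
  "ess_bounded f \<longleftrightarrow> f \<in> borel_measurable lebesgue01 \<and> (\<exists>C. AE t in lebesgue01. \<bar>f t\<bar> \<le> C)"
proof (cases "f \<in> borel_measurable lebesgue01")
  case True
  then have m: "(\<lambda>t. ereal \<bar>f t\<bar>) \<in> borel_measurable lebesgue01" by measurable
  show ?thesis
  proof
    assume "ess_bounded f"
    then have "esssup lebesgue01 (\<lambda>t. ereal \<bar>f t\<bar>) < \<infinity>" by (simp add: ess_bounded_def)
    then obtain C where C: "esssup lebesgue01 (\<lambda>t. ereal \<bar>f t\<bar>) \<le> ereal C"
      by (cases "esssup lebesgue01 (\<lambda>t. ereal \<bar>f t\<bar>)") auto
    have "AE t in lebesgue01. \<bar>f t\<bar> \<le> C"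
      using esssup_AE[of "\<lambda>t. ereal \<bar>f t\<bar>" lebesgue01]
    proof eventually_elim
      case (elim t)
      then have "ereal \<bar>f t\<bar> \<le> ereal C" using C by (rule order_trans)
      then show ?case by simp
    qed
    with True show "f \<in> borel_measurable lebesgue01 \<and> (\<exists>C. AE t in lebesgue01. \<bar>f t\<bar> \<le> C)"
      by blast
  next
    assume "f \<in> borel_measurable lebesgue01 \<and> (\<exists>C. AE t in lebesgue01. \<bar>f t\<bar> \<le> C)"
    then obtain C where C: "AE t in lebesgue01. \<bar>f t\<bar> \<le> C" by blast
    have "esssup lebesgue01 (\<lambda>t. ereal \<bar>f t\<bar>) \<le> ereal C"
      using m C by (intro esssup_I) auto
    then have "esssup lebesgue01 (\<lambda>t. ereal \<bar>f t\<bar>) < \<infinity>"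
      by (rule order_le_less_trans) simp
    then show "ess_bounded f" using True by (simp add: ess_bounded_def)
  qed
qed (simp add: ess_bounded_def)

lemma ess_boundedI:
  "f \<in> borel_measurable lebesgue01 \<Longrightarrow> AE t in lebesgue01. \<bar>f t\<bar> \<le> C \<Longrightarrow> ess_bounded f"
  unfolding ess_bounded_iff by blast

lemma ess_bounded_measurable: "ess_bounded f \<Longrightarrow> f \<in> borel_measurable lebesgue01"
  by (simp add: ess_bounded_def)

lemma ess_bounded_const: "ess_bounded (\<lambda>t. c)"
  by (rule ess_boundedI[where C = "\<bar>c\<bar>"]) auto

lemma ess_bounded_add:
  assumes "ess_bounded f" "ess_bounded g"
  shows "ess_bounded (\<lambda>t. f t + g t)"
proof -
  obtain C D where CD: "AE t in lebesgue01. \<bar>f t\<bar> \<le> C" "AE t in lebesgue01. \<bar>g t\<bar> \<le> D"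
    using assms unfolding ess_bounded_iff by blast
  have "AE t in lebesgue01. \<bar>f t + g t\<bar> \<le> C + D"
    using CD by eventually_elim linarith
  then show ?thesis
    by (rule ess_boundedI[OF borel_measurable_add[OF assms[THEN ess_bounded_measurable]]])
qed

lemma ess_bounded_scale:
  assumes "ess_bounded f"
  shows "ess_bounded (\<lambda>t. c * f t)"
proof -
  obtain C where C: "AE t in lebesgue01. \<bar>f t\<bar> \<le> C"
    using assms unfolding ess_bounded_iff by blast
  have "AE t in lebesgue01. \<bar>c * f t\<bar> \<le> \<bar>c\<bar> * C"
    using C by eventually_elim (simp add: abs_mult mult_left_mono)
  then show ?thesis
    by (rule ess_boundedI[OF borel_measurable_times
          [OF borel_measurable_const ess_bounded_measurable[OF assms]]])
qed

lemma ess_bounded_minus: "ess_bounded f \<Longrightarrow> ess_bounded (\<lambda>t. - f t)"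
  using ess_bounded_scale[of f "-1"] by simp

lemma ess_bounded_diff: "ess_bounded f \<Longrightarrow> ess_bounded g \<Longrightarrow> ess_bounded (\<lambda>t. f t - g t)"
  using ess_bounded_add[of f "\<lambda>t. - g t"] ess_bounded_minus[of g] by simp

quotient_type linf = "real \<Rightarrow> real" / partial: linf_rel
proof (rule part_equivpI)
  show "\<exists>f. linf_rel f f"
    using ess_bounded_const[of 0] by (auto simp: linf_rel_def)
  show "symp linf_rel"
    by (auto simp: symp_def linf_rel_def)
  show "transp linf_rel"
  proof (rule transpI)
    fix f g h assume "linf_rel f g" "linf_rel g h"
    then show "linf_rel f h"
      by (auto simp: linf_rel_def)
  qed
qed

definition ess_norm :: "(real \<Rightarrow> real) \<Rightarrow> real" where
  "ess_norm f = real_of_ereal (esssup lebesgue01 (\<lambda>t. ereal \<bar>f t\<bar>))"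

lemma
  assumes "ess_bounded f"
  shows ess_norm_nonneg: "0 \<le> ess_norm f"
    and AE_le_ess_norm: "AE t in lebesgue01. \<bar>f t\<bar> \<le> ess_norm f"
    and ess_norm_le_iff: "ess_norm f \<le> c \<longleftrightarrow> (AE t in lebesgue01. \<bar>f t\<bar> \<le> c)"
proof -
  have [measurable]: "f \<in> borel_measurable lebesgue01"
    using assms by (simp add: ess_bounded_def)
  let ?s = "esssup lebesgue01 (\<lambda>t. ereal \<bar>f t\<bar>)"
  have "esssup lebesgue01 (\<lambda>t. 0 :: ereal) \<le> ?s"
    by (rule esssup_mono) auto
  moreover have "esssup lebesgue01 (\<lambda>t. 0 :: ereal) = 0"
    by (rule esssup_const) (simp only: emeasure_lebesgue01, simp)
  ultimately have "0 \<le> ?s"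
    by simp
  moreover have "?s < \<infinity>"
    using assms by (simp add: ess_bounded_def)
  ultimately have s: "?s = ereal (ess_norm f)" and nn: "0 \<le> ess_norm f"
    by (auto simp: ess_norm_def ereal_real real_of_ereal_pos)
  show "0 \<le> ess_norm f" by (fact nn)
  show ae: "AE t in lebesgue01. \<bar>f t\<bar> \<le> ess_norm f"
    using esssup_AE[of "\<lambda>t. ereal \<bar>f t\<bar>" lebesgue01] unfolding s by simp
  show "ess_norm f \<le> c \<longleftrightarrow> (AE t in lebesgue01. \<bar>f t\<bar> \<le> c)"
  proof
    assume "ess_norm f \<le> c"
    with ae show "AE t in lebesgue01. \<bar>f t\<bar> \<le> c" by (auto elim: eventually_mono)
  next
    assume "AE t in lebesgue01. \<bar>f t\<bar> \<le> c"
    then have "?s \<le> ereal c" by (intro esssup_I) auto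
    then show "ess_norm f \<le> c" by (simp add: s)
  qed
qed

lemma ess_norm_cong:
  assumes "linf_rel f g"
  shows "ess_norm f = ess_norm g"
proof -
  have "(\<lambda>t. ereal \<bar>f t\<bar>) \<in> borel_measurable lebesgue01"
       "(\<lambda>t. ereal \<bar>g t\<bar>) \<in> borel_measurable lebesgue01"
    using assms by (auto simp: linf_rel_def ess_bounded_def)
  then have "esssup lebesgue01 (\<lambda>t. ereal \<bar>f t\<bar>) = esssup lebesgue01 (\<lambda>t. ereal \<bar>g t\<bar>)"
    using assms by (intro esssup_AE_cong) (auto simp: linf_rel_def)
  then show ?thesis by (simp add: ess_norm_def)
qed

instantiation linf :: real_normed_vector
begin

lift_definition zero_linf :: linf is "\<lambda>t. 0"
  by (auto simp: linf_rel_def ess_bounded_const)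

lift_definition plus_linf :: "linf \<Rightarrow> linf \<Rightarrow> linf" is "\<lambda>f g t. f t + g t"
  by (auto simp: linf_rel_def ess_bounded_add)

lift_definition uminus_linf :: "linf \<Rightarrow> linf" is "\<lambda>f t. - f t"
  by (auto simp: linf_rel_def ess_bounded_minus)

lift_definition minus_linf :: "linf \<Rightarrow> linf \<Rightarrow> linf" is "\<lambda>f g t. f t - g t"
  by (auto simp: linf_rel_def ess_bounded_diff)

lift_definition scaleR_linf :: "real \<Rightarrow> linf \<Rightarrow> linf" is "\<lambda>c f t. c * f t"
  by (auto simp: linf_rel_def ess_bounded_scale)

lift_definition norm_linf :: "linf \<Rightarrow> real" is ess_norm
  by (rule ess_norm_cong)

definition dist_linf :: "linf \<Rightarrow> linf \<Rightarrow> real" where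
  "dist_linf x y = norm (x - y)"

definition sgn_linf :: "linf \<Rightarrow> linf" where
  "sgn_linf x = scaleR (inverse (norm x)) x"

definition uniformity_linf :: "(linf \<times> linf) filter" where
  "uniformity_linf = (INF e\<in>{0<..}. principal {(x, y). dist x y < e})"

definition open_linf :: "linf set \<Rightarrow> bool" where
  "open_linf U \<longleftrightarrow> (\<forall>x\<in>U. eventually (\<lambda>(x', y). x' = x \<longrightarrow> y \<in> U) uniformity)"

instance
proof
  fix x y z :: linf and a b :: real
  show "x + y + z = x + (y + z)"
    by transfer (auto simp: linf_rel_def ess_bounded_add algebra_simps)
  show "x + y = y + x"
    by transfer (auto simp: linf_rel_def ess_bounded_add algebra_simps)
  show "0 + x = x"
    by transfer (auto simp: linf_rel_def)
  show "- x + x = 0"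
    by transfer (auto simp: linf_rel_def ess_bounded_const)
  show "x - y = x + - y"
    by transfer (auto simp: linf_rel_def ess_bounded_diff)
  show "a *\<^sub>R (x + y) = a *\<^sub>R x + a *\<^sub>R y"
    by transfer (auto simp: linf_rel_def distrib_left intro!: ess_bounded_add ess_bounded_scale)
  show "(a + b) *\<^sub>R x = a *\<^sub>R x + b *\<^sub>R x"
    by transfer (auto simp: linf_rel_def distrib_right intro!: ess_bounded_add ess_bounded_scale)
  show "a *\<^sub>R b *\<^sub>R x = (a * b) *\<^sub>R x"
    by transfer (auto simp: linf_rel_def mult.assoc intro!: ess_bounded_scale)
  show "1 *\<^sub>R x = x"
    by transfer (auto simp: linf_rel_def)
  show "dist x y = norm (x - y)"
    by (fact dist_linf_def)
  show "sgn x = scaleR (inverse (norm x)) x"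
    by (fact sgn_linf_def)
  show "uniformity = (INF e\<in>{0<..}. principal {(x, y :: linf). dist x y < e})"
    by (fact uniformity_linf_def)
  show "open U \<longleftrightarrow> (\<forall>x\<in>U. eventually (\<lambda>(x', y). x' = x \<longrightarrow> y \<in> U) uniformity)" for U :: "linf set"
    by (fact open_linf_def)
  show "norm x = 0 \<longleftrightarrow> x = 0"
  proof transfer
    fix f assume "linf_rel f f"
    then have f: "ess_bounded f" by (simp add: linf_rel_def)
    have "ess_norm f = 0 \<longleftrightarrow> ess_norm f \<le> 0" using ess_norm_nonneg[OF f] by auto
    also have "\<dots> \<longleftrightarrow> (AE t in lebesgue01. f t = 0)" by (simp add: ess_norm_le_iff[OF f])
    finally show "ess_norm f = 0 \<longleftrightarrow> linf_rel f (\<lambda>t. 0)"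
      using f by (simp add: linf_rel_def ess_bounded_const)
  qed
  show "norm (x + y) \<le> norm x + norm y"
  proof transfer
    fix f g assume "linf_rel f f" "linf_rel g g"
    then have f: "ess_bounded f" and g: "ess_bounded g" by (auto simp: linf_rel_def)
    have "AE t in lebesgue01. \<bar>f t + g t\<bar> \<le> ess_norm f + ess_norm g"
      using AE_le_ess_norm[OF f] AE_le_ess_norm[OF g] by eventually_elim linarith
    then show "ess_norm (\<lambda>t. f t + g t) \<le> ess_norm f + ess_norm g"
      by (simp add: ess_norm_le_iff ess_bounded_add f g)
  qed
  show "norm (a *\<^sub>R x) = \<bar>a\<bar> * norm x"
  proof transfer
    fix a f assume "linf_rel f f"
    then have f: "ess_bounded f" by (auto simp: linf_rel_def)
    have le: "ess_norm (\<lambda>t. c * g t) \<le> \<bar>c\<bar> * ess_norm g" if g: "ess_bounded g" for c g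
    proof -
      have "AE t in lebesgue01. \<bar>c * g t\<bar> \<le> \<bar>c\<bar> * ess_norm g"
        using AE_le_ess_norm[OF g] by eventually_elim (simp add: abs_mult mult_left_mono)
      then show ?thesis by (simp add: ess_norm_le_iff ess_bounded_scale g)
    qed
    show "ess_norm (\<lambda>t. a * f t) = \<bar>a\<bar> * ess_norm f"
    proof (cases "a = 0")
      case True
      then show ?thesis using le[OF f, of 0] ess_norm_nonneg[OF ess_bounded_const[of 0]] by simp
    next
      case False
      have "\<bar>a\<bar> * ess_norm f \<le> \<bar>a\<bar> * (\<bar>inverse a\<bar> * ess_norm (\<lambda>t. a * f t))"
        using le[OF ess_bounded_scale[OF f, of a], of "inverse a"] False
        by (intro mult_left_mono) (simp_all add: mult.assoc[symmetric])
      also have "\<dots> = ess_norm (\<lambda>t. a * f t)" using False by (simp add: mult.assoc[symmetric] abs_mult[symmetric])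
      finally show ?thesis using le[OF f, of a] by linarith
    qed
  qed
qed

end

lemma linf_representative:
  obtains f where "ess_bounded f" "x = abs_linf f"
proof -
  have "linf_rel (rep_linf x) (rep_linf x)" "x = abs_linf (rep_linf x)"
    using Quotient3_linf by (simp_all add: Quotient3_rep_reflp Quotient3_abs_rep)
  then show ?thesis using that by (auto simp: linf_rel_def)
qed

lemma abs_linf_diff:
  "ess_bounded f \<Longrightarrow> ess_bounded g \<Longrightarrow> abs_linf f - abs_linf g = abs_linf (\<lambda>t. f t - g t)"
  by (simp add: minus_linf.abs_eq linf_rel_def)

lemma norm_abs_linf: "ess_bounded f \<Longrightarrow> norm (abs_linf f) = ess_norm f"
  by (simp add: norm_linf.abs_eq linf_rel_def)

instance linf :: banach
proof
  fix X :: "nat \<Rightarrow> linf" assume X: "Cauchy X"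
  have "\<exists>f. ess_bounded f \<and> X n = abs_linf f" for n
    using linf_representative[of "X n"] by metis
  then obtain F where F: "\<And>n. ess_bounded (F n)" and XF: "\<And>n. X n = abs_linf (F n)"
    by metis
  have [measurable]: "F n \<in> borel_measurable lebesgue01" for n
    by (rule ess_bounded_measurable[OF F])
  have nX: "norm (X m - X n) = ess_norm (\<lambda>t. F m t - F n t)" for m n
    by (simp add: XF abs_linf_diff F norm_abs_linf ess_bounded_diff)
  have "AE t in lebesgue01. \<bar>F m t - F n t\<bar> \<le> norm (X m - X n)" for m n
    unfolding nX by (rule AE_le_ess_norm) (intro ess_bounded_diff F)
  then have "AE t in lebesgue01. \<forall>m n. \<bar>F m t - F n t\<bar> \<le> norm (X m - X n)"
    by (simp add: AE_all_countable)
  then have lim: "AE t in lebesgue01. (\<forall>m n. \<bar>F m t - F n t\<bar> \<le> norm (X m - X n)) \<and>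
      (\<lambda>n. F n t) \<longlonglongrightarrow> lim (\<lambda>n. F n t)"
  proof eventually_elim
    case (elim t)
    have "Cauchy (\<lambda>n. F n t)"
      unfolding Cauchy_def dist_real_def
    proof (intro allI impI)
      fix e :: real assume "e > 0"
      then obtain M where "\<forall>m\<ge>M. \<forall>n\<ge>M. norm (X m - X n) < e"
        using X unfolding Cauchy_def dist_norm by blast
      then show "\<exists>M. \<forall>m\<ge>M. \<forall>n\<ge>M. \<bar>F m t - F n t\<bar> < e"
        using elim by (meson order_le_less_trans)
    qed
    then show ?case
      using elim by (simp add: Cauchy_convergent_iff convergent_LIMSEQ_iff)
  qed
  define f where "f t = lim (\<lambda>n. F n t)" for t
  have [measurable]: "f \<in> borel_measurable lebesgue01"
    unfolding f_def by measurable
  have bound: "AE t in lebesgue01. \<bar>F m t - f t\<bar> \<le> e"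
    if e: "\<And>n. n \<ge> m \<Longrightarrow> norm (X m - X n) \<le> e" for m e
    using lim
  proof eventually_elim
    case (elim t)
    have "(\<lambda>n. \<bar>F m t - F n t\<bar>) \<longlonglongrightarrow> \<bar>F m t - f t\<bar>"
      using elim unfolding f_def by (intro tendsto_intros) blast
    moreover have "\<forall>n\<ge>m. \<bar>F m t - F n t\<bar> \<le> e"
      using elim e by (meson order_trans)
    ultimately show ?case
      by (meson LIMSEQ_le_const2)
  qed
  have tail: "\<exists>M. \<forall>m\<ge>M. AE t in lebesgue01. \<bar>F m t - f t\<bar> \<le> e" if "e > 0" for e
  proof -
    obtain M where "\<forall>m\<ge>M. \<forall>n\<ge>M. norm (X m - X n) < e"
      using X \<open>e > 0\<close> unfolding Cauchy_def dist_norm by blast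
    then have "AE t in lebesgue01. \<bar>F m t - f t\<bar> \<le> e" if "m \<ge> M" for m
      using that by (intro bound) (meson order_trans less_imp_le)
    then show ?thesis by blast
  qed
  have f: "ess_bounded f"
  proof -
    obtain M where M: "AE t in lebesgue01. \<bar>F M t - f t\<bar> \<le> 1"
      using tail[of 1] by auto
    have "AE t in lebesgue01. \<bar>f t\<bar> \<le> ess_norm (F M) + 1"
      using M AE_le_ess_norm[OF F[of M]] by eventually_elim linarith
    then show ?thesis by (rule ess_boundedI[rotated]) auto
  qed
  have "X \<longlonglongrightarrow> abs_linf f"
  proof (rule LIMSEQ_I)
    fix e :: real assume "e > 0"
    then obtain M where M: "\<forall>m\<ge>M. AE t in lebesgue01. \<bar>F m t - f t\<bar> \<le> e / 2"
      using tail[of "e / 2"] by auto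
    have "norm (X m - abs_linf f) < e" if "m \<ge> M" for m
    proof -
      have "norm (X m - abs_linf f) \<le> e / 2"
        using M that
        by (simp add: XF abs_linf_diff F f norm_abs_linf ess_bounded_diff ess_norm_le_iff
            del: le_divide_eq_numeral1)
      then show ?thesis using \<open>e > 0\<close> by linarith
    qed
    then show "\<exists>M. \<forall>m\<ge>M. norm (X m - abs_linf f) < e" by blast
  qed
  then show "convergent X" by (auto simp: convergent_def)
qed


section \<open>The countable attaining strong diameter two property\<close>

definition norms :: "'a::real_normed_vector set \<Rightarrow> ('a \<Rightarrow>\<^sub>L real) set \<Rightarrow> bool" where
  "norms B A \<longleftrightarrow>
     (\<forall>l\<in>{0<..<1}. \<forall>\<phi>\<in>A. \<exists>x\<in>B - {0}. blinfun_apply \<phi> x \<ge> l * norm \<phi> * norm x)"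

text \<open>The Banach space is passed as a type, so that \<open>ASD2P1_omega TYPE('a)\<close> says that
  \<^typ>\<open>'a\<close> has the 1-ASD2P\<open>\<^sub>\<omega>\<close>; \<^typ>\<open>'a \<Rightarrow>\<^sub>L real\<close> is its dual with the operator norm.\<close>

definition ASD2P1_omega :: "'a::banach itself \<Rightarrow> bool" where
  "ASD2P1_omega _ \<longleftrightarrow>
     (\<forall>A :: ('a \<Rightarrow>\<^sub>L real) set. countable A \<longrightarrow> A \<subseteq> sphere 0 1 \<longrightarrow>
        (\<exists>(B :: 'a set) (\<phi> :: 'a \<Rightarrow>\<^sub>L real). B \<subseteq> sphere 0 1 \<and> \<phi> \<in> sphere 0 1 \<and> norms B A \<and>
               (\<forall>x\<in>B. blinfun_apply \<phi> x = 1)))"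

end

theory Submission
  imports Defs
begin

text \<open>
  A bounded functional on \<^typ>\<open>linf\<close> is, morally, a finitely additive measure vanishing on null
  sets. If an interval is cut into many pieces, such a measure must be small on at least one of
  them, since otherwise the norm would be exceeded by adding up functions that witness largeness on
  the separate pieces (\<open>small_on_subinterval\<close>). Iterating this along an enumeration of
  all pairs of a functional in the given countable set and a tolerance produces a decreasing
  sequence of intervals \<open>I\<^sub>k\<close> of positive length such that every functional in the set is as small
  as desired on some \<open>I\<^sub>k\<close> (\<open>small_on_nested_intervals\<close>).

  Let \<open>B\<close> consist of the functions in the unit ball that equal 1 almost everywhere on some \<open>I\<^sub>k\<close>.
  It norms the set: an element of the unit ball that almost attains the norm of a functional may be
  overwritten by the value 1 on an interval where that functional is small, at a negligible cost
  (\<open>patch_one\<close>). On the other hand a single functional of norm 1 takes the value 1 on all of \<open>B\<close>.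
  The average over \<open>I\<^sub>k\<close> does this for the functions that equal 1 on \<open>I\<^sub>k\<close>; these
  classes increase with \<open>k\<close>, so by weak-star compactness one functional does it for their union
  (\<open>norm_one_functional_on_increasing_union\<close>).
\<close>

section \<open>Weak-star compactness and increasing unions\<close>

text \<open>
  This is the Banach--Alaoglu theorem, stated for functions with the topology of pointwise
  convergence so that it follows from Tychonoff's theorem: the set is cut out of a product of compact
  intervals by closed conditions.
\<close>
lemma compact_linear_contractions:
  "compact {T :: 'a::real_normed_vector \<Rightarrow> real. linear T \<and> (\<forall>x. \<bar>T x\<bar> \<le> norm x)}"
proof -
  let ?K = "PiE UNIV (\<lambda>x :: 'a. {- norm x..norm x})"
  let ?Add = "\<lambda>x y. {T :: 'a \<Rightarrow> real. T (x + y) = T x + T y}"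
  let ?Scale = "\<lambda>r x. {T :: 'a \<Rightarrow> real. T (r *\<^sub>R x) = r *\<^sub>R T x}"
  have "compactin (product_topology (\<lambda>_. euclidean) UNIV) ?K"
    unfolding compactin_PiE by simp
  then have "compact ?K"
    by (simp add: euclidean_product_topology)
  moreover have "closed ((\<Inter>x y. ?Add x y) \<inter> (\<Inter>r x. ?Scale r x))"
    by (intro closed_Int closed_INT ballI closed_Collect_eq continuous_intros
        continuous_on_product_coordinates)
  ultimately have "compact (?K \<inter> ((\<Inter>x y. ?Add x y) \<inter> (\<Inter>r x. ?Scale r x)))"
    by (rule compact_Int_closed)
  also have "?K \<inter> ((\<Inter>x y. ?Add x y) \<inter> (\<Inter>r x. ?Scale r x))
      = {T. linear T \<and> (\<forall>x. \<bar>T x\<bar> \<le> norm x)}"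
    by (auto simp: linear_iff PiE_iff abs_le_iff minus_le_iff)
  finally show ?thesis .
qed

text \<open>
  The functionals in the dual unit ball with value 1 on a given set form a weak-star compact set.
  For an increasing sequence of sets these compact sets decrease, so if none is empty then neither is
  their intersection.
\<close>
lemma norm_one_functional_on_increasing_union:
  fixes B :: "nat \<Rightarrow> 'a::real_normed_vector set"
  assumes "incseq B"
    and local: "\<And>k. \<exists>\<psi> :: 'a \<Rightarrow>\<^sub>L real. norm \<psi> \<le> 1 \<and> (\<forall>x\<in>B k. blinfun_apply \<psi> x = 1)"
  shows "\<exists>\<psi> :: 'a \<Rightarrow>\<^sub>L real. norm \<psi> \<le> 1 \<and> (\<forall>x\<in>\<Union>k. B k. blinfun_apply \<psi> x = 1)"
proof -
  let ?L = "{T :: 'a \<Rightarrow> real. linear T \<and> (\<forall>x. \<bar>T x\<bar> \<le> norm x)}"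
  let ?C = "\<lambda>k. {T :: 'a \<Rightarrow> real. \<forall>x\<in>B k. T x = 1}"
  have "?L \<inter> (\<Inter>k\<in>UNIV. ?C k) \<noteq> {}"
  proof (rule compact_imp_fip_image[OF compact_linear_contractions])
    fix k
    have "?C k = (\<Inter>x\<in>B k. {T. T x = 1})" by auto
    then show "closed (?C k)"
      by (simp add: closed_INT closed_Collect_eq)
  next
    fix J :: "nat set" assume "finite J"
    then obtain N where N: "\<forall>k\<in>J. k \<le> N" using finite_nat_set_iff_bounded_le by blast
    obtain \<psi> :: "'a \<Rightarrow>\<^sub>L real" where \<psi>: "norm \<psi> \<le> 1" "\<forall>x\<in>B N. blinfun_apply \<psi> x = 1"
      using local by blast
    have "\<bar>blinfun_apply \<psi> x\<bar> \<le> norm x" for x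
      using norm_blinfun[of \<psi> x] mult_right_mono[OF \<psi>(1), of "norm x"] by simp
    moreover have "linear (blinfun_apply \<psi>)"
      by (simp add: linear_iff blinfun.add_right blinfun.scaleR_right)
    moreover have "blinfun_apply \<psi> x = 1" if "k \<in> J" "x \<in> B k" for k x
      using that N \<psi>(2) incseqD[OF \<open>incseq B\<close>] by blast
    ultimately show "?L \<inter> (\<Inter>k\<in>J. ?C k) \<noteq> {}" by blast
  qed
  then obtain T where T: "linear T" "\<And>x. \<bar>T x\<bar> \<le> norm x" "\<And>k x. x \<in> B k \<Longrightarrow> T x = 1"
    by auto
  then have "bounded_linear T"
    by (intro bounded_linear_intro[where K = 1]) (simp_all add: linear_add linear_scale)
  then have app: "blinfun_apply (Blinfun T) = T" by (rule bounded_linear_Blinfun_apply)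
  have "norm (Blinfun T) \<le> 1"
    by (rule norm_blinfun_bound) (simp_all add: app T(2))
  then show ?thesis using T(3) by (intro exI[of _ "Blinfun T"]) (auto simp: app)
qed

section \<open>Pointwise description of the operations\<close>

lemma ess_bounded_rep: "ess_bounded (rep_linf x)"
  using Quotient3_rep_reflp[OF Quotient3_linf, of x] by (simp add: linf_rel_def)

lemma abs_rep_linf: "abs_linf (rep_linf x) = x"
  by (rule Quotient3_abs_rep[OF Quotient3_linf])

lemma AE_rep_abs:
  assumes "ess_bounded f"
  shows "AE t in lebesgue01. rep_linf (abs_linf f) t = f t"
  using Quotient3_rep_abs[OF Quotient3_linf, of f] assms by (simp add: linf_rel_def)

lemma AE_rep_add: "AE t in lebesgue01. rep_linf (x + y) t = rep_linf x t + rep_linf y t"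
  using AE_rep_abs[OF ess_bounded_add[OF ess_bounded_rep[of x] ess_bounded_rep[of y]]]
    plus_linf.abs_eq[of "rep_linf x" "rep_linf y"]
  by (simp add: linf_rel_def ess_bounded_rep abs_rep_linf)

lemma AE_rep_scaleR: "AE t in lebesgue01. rep_linf (c *\<^sub>R x) t = c * rep_linf x t"
  using AE_rep_abs[OF ess_bounded_scale[OF ess_bounded_rep[of x]], of c]
    scaleR_linf.abs_eq[of "rep_linf x" c]
  by (simp add: linf_rel_def ess_bounded_rep abs_rep_linf)

lemma norm_linf_le_iff: "norm x \<le> c \<longleftrightarrow> (AE t in lebesgue01. \<bar>rep_linf x t\<bar> \<le> c)"
  using norm_abs_linf[OF ess_bounded_rep[of x]] ess_norm_le_iff[OF ess_bounded_rep[of x]]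
  by (simp add: abs_rep_linf)

section \<open>Averages over intervals\<close>

text \<open>
  The functional is the average over the interval, which the essential supremum dominates.
\<close>
lemma average_functional:
  assumes "0 \<le> a" "a < b" "b \<le> 1"
  shows "\<exists>\<psi> :: linf \<Rightarrow>\<^sub>L real. norm \<psi> \<le> 1 \<and>
    (\<forall>x. (AE t in lebesgue01. t \<in> {a<..b} \<longrightarrow> rep_linf x t = 1) \<longrightarrow> blinfun_apply \<psi> x = 1)"
proof -
  let ?i = "indicator {a<..b} :: real \<Rightarrow> real"
  define T where "T x = (\<integral>t. ?i t * rep_linf x t \<partial>lebesgue01) / (b - a)" for x
  interpret finite_measure lebesgue01
    by (rule finite_measureI) (simp only: emeasure_lebesgue01, simp)
  have [measurable]: "rep_linf x \<in> borel_measurable lebesgue01" for x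
    by (rule ess_bounded_measurable[OF ess_bounded_rep])
  have [measurable]: "?i \<in> borel_measurable lebesgue01"
    by (intro borel_measurable_indicator) (use assms in \<open>auto simp: sets_restrict_space_iff\<close>)
  have bound: "AE t in lebesgue01. \<bar>rep_linf x t\<bar> \<le> norm x" for x
    using norm_linf_le_iff[of x "norm x"] by simp
  have int: "integrable lebesgue01 (\<lambda>t. ?i t * rep_linf x t)" for x
  proof (rule integrable_const_bound)
    show "AE t in lebesgue01. norm (?i t * rep_linf x t) \<le> norm x"
      using bound[of x] by eventually_elim (auto simp: indicator_def)
  qed measurable
  have len: "(\<integral>t. ?i t \<partial>lebesgue01) = b - a" and inti: "integrable lebesgue01 ?i"
  proof -
    have "{a<..b} \<inter> {0..1} = {a<..b}" using assms by auto
    then have "measure lebesgue01 {a<..b} = b - a"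
      using assms by (subst measure_restrict_space) (auto simp: measure_def)
    then show "(\<integral>t. ?i t \<partial>lebesgue01) = b - a"
      using assms by (simp add: Int_absorb2 \<open>{a<..b} \<inter> {0..1} = {a<..b}\<close>)
    show "integrable lebesgue01 ?i"
      by (rule integrable_const_bound[of _ 1]) (auto simp: indicator_def)
  qed
  have "T (x + y) = T x + T y" for x y
  proof -
    have "(\<integral>t. ?i t * rep_linf (x + y) t \<partial>lebesgue01)
        = (\<integral>t. ?i t * rep_linf x t + ?i t * rep_linf y t \<partial>lebesgue01)"
      using AE_rep_add[of x y]
      by (intro integral_cong_AE) (auto elim!: eventually_mono simp: distrib_left)
    then show ?thesis by (simp add: T_def int add_divide_distrib)
  qed
  moreover have "T (r *\<^sub>R x) = r *\<^sub>R T x" for r x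
  proof -
    have "(\<integral>t. ?i t * rep_linf (r *\<^sub>R x) t \<partial>lebesgue01)
        = (\<integral>t. r * (?i t * rep_linf x t) \<partial>lebesgue01)"
      using AE_rep_scaleR[of r x]
      by (intro integral_cong_AE) (auto elim!: eventually_mono)
    then show ?thesis by (simp add: T_def)
  qed
  moreover have T_le: "\<bar>T x\<bar> \<le> norm x" for x
  proof -
    have "\<bar>\<integral>t. ?i t * rep_linf x t \<partial>lebesgue01\<bar> \<le> (\<integral>t. \<bar>?i t * rep_linf x t\<bar> \<partial>lebesgue01)"
      by (rule integral_abs_bound)
    also have "\<dots> \<le> (\<integral>t. norm x * ?i t \<partial>lebesgue01)"
    proof (intro integral_mono_AE integrable_abs integrable_mult_right int inti)
      show "AE t in lebesgue01. \<bar>?i t * rep_linf x t\<bar> \<le> norm x * ?i t"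
        using bound[of x] by eventually_elim (auto simp: indicator_def)
    qed
    also have "\<dots> = norm x * (b - a)" by (simp only: integral_mult_right_zero len)
    finally show ?thesis using assms by (simp add: T_def pos_divide_le_eq)
  qed
  ultimately have "bounded_linear T"
    by (intro bounded_linear_intro[where K = 1]) simp_all
  then have app: "blinfun_apply (Blinfun T) = T" by (rule bounded_linear_Blinfun_apply)
  have "norm (Blinfun T) \<le> 1"
    by (rule norm_blinfun_bound) (simp_all add: app T_le)
  moreover have "T x = 1" if "AE t in lebesgue01. t \<in> {a<..b} \<longrightarrow> rep_linf x t = 1" for x
  proof -
    have "(\<integral>t. ?i t * rep_linf x t \<partial>lebesgue01) = (\<integral>t. ?i t \<partial>lebesgue01)"
    proof (rule integral_cong_AE)
      show "AE t in lebesgue01. ?i t * rep_linf x t = ?i t"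
        using that by eventually_elim (auto simp: indicator_def)
    qed measurable
    then show ?thesis using assms by (simp only: T_def len) simp
  qed
  ultimately show ?thesis by (intro exI[of _ "Blinfun T"]) (simp add: app)
qed

section \<open>Functionals on short intervals\<close>

text \<open>
  If the functional is integration against a finitely additive measure, this bounds by \<open>\<epsilon>\<close> the
  total variation of that measure on \<open>I\<close>. Replacing \<open>x\<close> by \<open>- x\<close> turns the one-sided bound into a
  two-sided one.
\<close>
definition small_on :: "real set \<Rightarrow> (linf \<Rightarrow>\<^sub>L real) \<Rightarrow> real \<Rightarrow> bool" where
  "small_on I \<phi> \<epsilon> \<longleftrightarrow>
     (\<forall>x. norm x \<le> 1 \<longrightarrow> (AE t in lebesgue01. t \<notin> I \<longrightarrow> rep_linf x t = 0) \<longrightarrow> blinfun_apply \<phi> x \<le> \<epsilon>)"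

text \<open>
  Functions in the unit ball with disjoint supports have their sum in the unit ball. If the
  functional were large on every subinterval, splitting into \<open>n\<close> pieces would give an element of the
  unit ball with value at least \<open>n * \<epsilon>\<close>, for each \<open>n\<close>.
\<close>
lemma small_on_subinterval:
  assumes "a < b" "0 < \<epsilon>"
  shows "\<exists>c d. a \<le> c \<and> c < d \<and> d \<le> b \<and> small_on {c<..d} \<phi> \<epsilon>"
proof (rule ccontr)
  assume "\<not> ?thesis"
  then have big: "\<exists>x. norm x \<le> 1 \<and> (AE t in lebesgue01. t \<notin> {c<..d} \<longrightarrow> rep_linf x t = 0) \<and> \<epsilon> \<le> blinfun_apply \<phi> x"
    if "a \<le> c" "c < d" "d \<le> b" for c d
    using that unfolding small_on_def by (meson linear)
  \<comment> \<open>Splitting off one half at a time lets the count grow by induction: the left half carries \<open>n\<close>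
    witnesses by the induction hypothesis, the right half one more.\<close>
  have pile: "\<exists>x. norm x \<le> 1 \<and> (AE t in lebesgue01. t \<notin> {c<..d} \<longrightarrow> rep_linf x t = 0)
      \<and> real n * \<epsilon> \<le> blinfun_apply \<phi> x" if "a \<le> c" "c < d" "d \<le> b" for c d n
    using that
  proof (induction n arbitrary: d)
    case 0
    have "AE t in lebesgue01. rep_linf 0 t = 0"
      using AE_rep_scaleR[of 0 0] by simp
    then show ?case by (intro exI[of _ 0]) (auto elim!: eventually_mono)
  next
    case (Suc n)
    define m where "m = (c + d) / 2"
    have m: "c < m" "m < d" using Suc.prems by (auto simp: m_def)
    obtain x where x: "norm x \<le> 1" "AE t in lebesgue01. t \<notin> {c<..m} \<longrightarrow> rep_linf x t = 0"
        "real n * \<epsilon> \<le> blinfun_apply \<phi> x"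
      using Suc.IH[of m] Suc.prems m by auto
    obtain y where y: "norm y \<le> 1" "AE t in lebesgue01. t \<notin> {m<..d} \<longrightarrow> rep_linf y t = 0"
        "\<epsilon> \<le> blinfun_apply \<phi> y"
      using big[of m d] Suc.prems m by auto
    have "AE t in lebesgue01. \<bar>rep_linf (x + y) t\<bar> \<le> 1"
      using x(2) y(2) x(1)[unfolded norm_linf_le_iff] y(1)[unfolded norm_linf_le_iff] AE_rep_add[of x y]
      by eventually_elim (auto simp: not_less not_le)
    then have "norm (x + y) \<le> 1" by (simp only: norm_linf_le_iff)
    moreover have "AE t in lebesgue01. t \<notin> {c<..d} \<longrightarrow> rep_linf (x + y) t = 0"
      using x(2) y(2) AE_rep_add[of x y] by eventually_elim (use m in auto)
    moreover have "real (Suc n) * \<epsilon> \<le> blinfun_apply \<phi> (x + y)"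
      using x(3) y(3) by (simp add: blinfun.add_right algebra_simps)
    ultimately show ?case by blast
  qed
  obtain n where "norm \<phi> < real n * \<epsilon>"
    using reals_Archimedean3[OF \<open>0 < \<epsilon>\<close>] by blast
  moreover obtain x where "norm x \<le> 1" "real n * \<epsilon> \<le> blinfun_apply \<phi> x"
    using pile[of a b n] \<open>a < b\<close> by blast
  moreover have "blinfun_apply \<phi> x \<le> norm \<phi> * norm x" using norm_blinfun[of \<phi> x] by simp
  moreover have "norm \<phi> * norm x \<le> norm \<phi>"
    using \<open>norm x \<le> 1\<close> by (simp add: mult_left_le)
  ultimately show False by linarith
qed

lemma small_on_nested_intervals:
  assumes "\<And>k :: nat. 0 < \<epsilon> k"
  obtains a b where "\<And>k. 0 \<le> a k" "\<And>k. a k < b k" "\<And>k. b k \<le> 1" "incseq a" "decseq b"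
    "\<And>k. small_on {a k<..b k} (\<phi> k) (\<epsilon> k)"
proof -
  let ?P = "\<lambda>k I. 0 \<le> fst I \<and> fst I < snd I \<and> snd I \<le> 1 \<and> small_on {fst I<..snd I} (\<phi> k) (\<epsilon> k)"
  have "\<exists>f. \<forall>k. ?P k (f k) \<and> (fst (f k) \<le> fst (f (Suc k)) \<and> snd (f (Suc k)) \<le> snd (f k))"
  proof (rule dependent_nat_choice)
    show "\<exists>I. ?P 0 I"
      using small_on_subinterval[of 0 1 "\<epsilon> 0" "\<phi> 0"] assms by auto
  next
    fix I :: "real \<times> real" and k assume "?P k I"
    moreover obtain c d where "fst I \<le> c" "c < d" "d \<le> snd I"
        "small_on {c<..d} (\<phi> (Suc k)) (\<epsilon> (Suc k))"
      using small_on_subinterval[of "fst I" "snd I"] assms[of "Suc k"] \<open>?P k I\<close> by blast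
    ultimately show "\<exists>J. ?P (Suc k) J \<and> (fst I \<le> fst J \<and> snd J \<le> snd I)"
      by (intro exI[of _ "(c, d)"]) auto
  qed
  then obtain f where "\<And>k. ?P k (f k)" "\<And>k. fst (f k) \<le> fst (f (Suc k))"
      "\<And>k. snd (f (Suc k)) \<le> snd (f k)"
    by blast
  then show ?thesis
    by (intro that[of "fst \<circ> f" "snd \<circ> f"]) (auto intro: incseq_SucI decseq_SucI)
qed

lemma approx_norm_on_unit_ball:
  fixes \<phi> :: "'a::real_normed_vector \<Rightarrow>\<^sub>L real"
  assumes "c < norm \<phi>"
  obtains x where "norm x \<le> 1" "c < blinfun_apply \<phi> x"
proof (rule ccontr)
  assume "\<not> thesis"
  then have le: "blinfun_apply \<phi> x \<le> c" if "norm x \<le> 1" for x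
    using that \<open>\<And>x. norm x \<le> 1 \<Longrightarrow> c < blinfun_apply \<phi> x \<Longrightarrow> thesis\<close> by (meson not_le)
  have "norm \<phi> \<le> c"
  proof (rule norm_blinfun_bound)
    show "0 \<le> c" using le[of 0] by simp
    fix x
    have "blinfun_apply \<phi> (z /\<^sub>R norm z) \<le> c" for z by (rule le) (cases "z = 0"; simp)
    from this[of x] this[of "- x"] have "\<bar>blinfun_apply \<phi> x\<bar> / norm x \<le> c"
      by (simp add: blinfun.scaleR_right blinfun.minus_right abs_if divide_inverse mult.commute)
    then show "norm (blinfun_apply \<phi> x) \<le> c * norm x"
      by (cases "x = 0") (simp_all add: pos_divide_le_eq)
  qed
  with assms show False by simp
qed

text \<open>
  The patched function differs from \<open>x\<close> only on the interval and by at most 2, hence the cost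
  \<open>2 * \<epsilon>\<close>.
\<close>
lemma patch_one:
  assumes "small_on {a<..b} \<phi> \<epsilon>" "norm x \<le> 1"
  obtains y where "norm y \<le> 1" "AE t in lebesgue01. t \<in> {a<..b} \<longrightarrow> rep_linf y t = 1"
    "blinfun_apply \<phi> x - 2 * \<epsilon> \<le> blinfun_apply \<phi> y"
proof -
  define g where "g t = (if t \<in> {a<..b} then 1 else rep_linf x t)" for t
  have [measurable]: "rep_linf x \<in> borel_measurable lebesgue01"
    by (rule ess_bounded_measurable[OF ess_bounded_rep])
  have "{t \<in> space lebesgue01. t \<in> {a<..b}} \<in> sets lebesgue01"
    by (auto simp: sets_restrict_space_iff)
  then have "g \<in> borel_measurable lebesgue01"
    unfolding g_def by (intro measurable_If) auto
  moreover have "AE t in lebesgue01. \<bar>g t\<bar> \<le> 1"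
    using assms(2)[unfolded norm_linf_le_iff] by eventually_elim (simp add: g_def)
  ultimately have g: "ess_bounded g" "norm (abs_linf g) \<le> 1"
    using ess_boundedI[of g 1] by (simp_all add: norm_abs_linf ess_norm_le_iff)
  note rep_g = AE_rep_abs[OF g(1)]
  let ?y = "abs_linf g"
  \<comment> \<open>Smallness refers to the unit ball, which contains half the difference.\<close>
  let ?z = "(1/2) *\<^sub>R (x + (- 1) *\<^sub>R ?y)"
  have "norm (x - ?y) \<le> 2" using norm_triangle_ineq4[of x ?y] assms(2) g(2) by linarith
  then have "norm ?z \<le> 1" by simp
  moreover have "AE t in lebesgue01. t \<notin> {a<..b} \<longrightarrow> rep_linf ?z t = 0"
    using rep_g AE_rep_scaleR[of "1/2" "x + (- 1) *\<^sub>R ?y"] AE_rep_add[of x "(- 1) *\<^sub>R ?y"]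
      AE_rep_scaleR[of "- 1" ?y]
    by eventually_elim (auto simp: g_def split: if_splits)
  ultimately have "blinfun_apply \<phi> ?z \<le> \<epsilon>" using assms(1) unfolding small_on_def by blast
  then have "blinfun_apply \<phi> x - 2 * \<epsilon> \<le> blinfun_apply \<phi> ?y"
    by (simp add: blinfun.scaleR_right blinfun.diff_right)
  moreover have "AE t in lebesgue01. t \<in> {a<..b} \<longrightarrow> rep_linf ?y t = 1"
    using rep_g by eventually_elim (simp add: g_def)
  ultimately show ?thesis using that g(2) by blast
qed

section \<open>The countable attaining property of the space\<close>

theorem corollary6p6:
  shows "ASD2P1_omega TYPE(linf)"
  unfolding ASD2P1_omega_def
proof (intro allI impI)
  fix A :: "(linf \<Rightarrow>\<^sub>L real) set" assume A: "countable A" "A \<subseteq> sphere 0 1"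
  \<comment> \<open>Decoding \<open>k\<close> as a pair runs through every functional in \<open>A\<close> with every tolerance
    \<open>1 / (m + 1)\<close>. For empty \<open>A\<close> the enumeration has an arbitrary value, which is harmless since
    smallness on some interval holds for every functional.\<close>
  define \<phi> where "\<phi> k = from_nat_into A (fst (prod_decode k))" for k
  define \<epsilon> :: "nat \<Rightarrow> real" where "\<epsilon> k = 1 / (real (snd (prod_decode k)) + 1)" for k
  have "0 < \<epsilon> k" for k by (simp add: \<epsilon>_def)
  then obtain a b where ab: "\<And>k. 0 \<le> a k" "\<And>k. a k < b k" "\<And>k. b k \<le> 1" "incseq a" "decseq b"
      and small: "\<And>k. small_on {a k<..b k} (\<phi> k) (\<epsilon> k)"
    using small_on_nested_intervals[of \<epsilon> \<phi>] by blast
  define B where "B k = {x. norm x \<le> 1 \<and>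
      (AE t in lebesgue01. t \<in> {a k<..b k} \<longrightarrow> rep_linf x t = 1)}" for k
  have "incseq B"
  proof (rule incseq_SucI)
    fix k
    have "{a (Suc k)<..b (Suc k)} \<subseteq> {a k<..b k}"
      using incseq_SucD[OF ab(4), of k] decseq_SucD[OF ab(5), of k] by auto
    then show "B k \<subseteq> B (Suc k)"
      unfolding B_def by (auto elim!: eventually_mono)
  qed
  have avg: "\<exists>\<psi> :: linf \<Rightarrow>\<^sub>L real. norm \<psi> \<le> 1 \<and> (\<forall>x\<in>B k. blinfun_apply \<psi> x = 1)" for k
    using average_functional[OF ab(1,2,3), of k] unfolding B_def by blast
  obtain \<psi> :: "linf \<Rightarrow>\<^sub>L real"
    where \<psi>: "norm \<psi> \<le> 1" "\<And>k x. x \<in> B k \<Longrightarrow> blinfun_apply \<psi> x = 1"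
    using norm_one_functional_on_increasing_union[OF \<open>incseq B\<close> avg] by blast
  \<comment> \<open>Both norms are at most 1, and \<open>\<psi> x = 1\<close> forces equality in each.\<close>
  have norms_B: "norm x = 1 \<and> norm \<psi> = 1" if "x \<in> B k" for x k
  proof -
    have "norm x \<le> 1" using that by (simp add: B_def)
    moreover have "1 \<le> norm \<psi> * norm x"
      using norm_blinfun[of \<psi> x] \<psi>(2)[OF that] by simp
    moreover have "norm \<psi> * norm x \<le> norm x" "norm \<psi> * norm x \<le> norm \<psi>"
      using \<psi>(1) \<open>norm x \<le> 1\<close> by (simp_all add: mult_left_le mult_left_le_one_le)
    ultimately show ?thesis using \<psi>(1) by linarith
  qed
  have "norms (\<Union>k. B k) A"
    unfolding norms_def
  proof (intro ballI)
    fix l :: real and \<eta> assume l: "l \<in> {0<..<1}" and "\<eta> \<in> A"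
    then have n\<eta>: "norm \<eta> = 1" using A(2) by auto
    \<comment> \<open>One \<open>\<delta>\<close> is lost in nearly attaining the norm and two in patching.\<close>
    define \<delta> where "\<delta> = (1 - l) / 3"
    have \<delta>: "\<delta> > 0" using l by (simp add: \<delta>_def)
    obtain i where i: "from_nat_into A i = \<eta>"
      using from_nat_into_surj[OF A(1) \<open>\<eta> \<in> A\<close>] by blast
    obtain m where m: "1 / (real m + 1) < \<delta>"
      using reals_Archimedean[OF \<delta>] by (auto simp: inverse_eq_divide add.commute)
    define k where "k = prod_encode (i, m)"
    have k: "\<phi> k = \<eta>" "\<epsilon> k < \<delta>" using i m by (simp_all add: \<phi>_def \<epsilon>_def k_def)
    obtain x where x: "norm x \<le> 1" "1 - \<delta> < blinfun_apply \<eta> x"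
      using approx_norm_on_unit_ball[of "1 - \<delta>" \<eta>] n\<eta> \<delta> by auto
    obtain y where y: "norm y \<le> 1" "AE t in lebesgue01. t \<in> {a k<..b k} \<longrightarrow> rep_linf y t = 1"
        "blinfun_apply \<eta> x - 2 * \<epsilon> k \<le> blinfun_apply \<eta> y"
      using patch_one[OF small[of k] x(1)] k(1) by metis
    then have "y \<in> B k" by (simp add: B_def)
    then have "norm y = 1" using norms_B by blast
    moreover have "l \<le> blinfun_apply \<eta> y" using y(3) x(2) k(2) by (simp add: \<delta>_def field_simps)
    ultimately show "\<exists>x\<in>(\<Union>k. B k) - {0}. l * norm \<eta> * norm x \<le> blinfun_apply \<eta> x"
      using \<open>y \<in> B k\<close> n\<eta> by (intro bexI[of _ y]) auto
  qed
  moreover have "norm \<psi> = 1"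
  proof -
    \<comment> \<open>The constant function 1 guarantees a point of the union even when \<open>A\<close> is empty.\<close>
    have "abs_linf (\<lambda>t. 1) \<in> B 0"
      using AE_rep_abs[OF ess_bounded_const[of 1]]
      by (auto simp: B_def norm_linf_le_iff elim!: eventually_mono)
    then show ?thesis using norms_B by blast
  qed
  ultimately show "\<exists>(B :: linf set) (\<phi> :: linf \<Rightarrow>\<^sub>L real). B \<subseteq> sphere 0 1 \<and> \<phi> \<in> sphere 0 1 \<and>
      norms B A \<and> (\<forall>x\<in>B. blinfun_apply \<phi> x = 1)"
    using norms_B \<psi>(2) by (intro exI[of _ "\<Union>k. B k"] exI[of _ \<psi>]) auto
qed

end
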